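(* Let $\gamma>0$, $r\ge1$, and let $\mathcal L_r$ be the class of all $r$-spike configurations $\ell_1>\ell_2>\dots>\ell_r>1$. (a) (Minimax $\kappa$-loss.) $$\inf_\eta\ \sup_{(\ell_i)\in\mathcal L_r}\kappa(\Delta((\ell_i);\eta(\cdot)))=\kappa_1^*(\infty,\gamma)=\frac{1+\sqrt{\frac{\gamma}{\gamma+1}}}{1-\sqrt{\frac{\gamma}{\gamma+1}}},$$ where the infimum is over all (possibly joint) nonlinearities $\eta$ and $\kappa_1^*(\infty,\gamma)=\lim_{\ell\to\infty}\kappa_1^*(\ell;\gamma)$. (b) (Minimax shrinker.) The pointwise limit $\eta_{mm}(\cdot;\gamma)=\eta_m^*(\cdot;\infty,\gamma)=\lim_{\ell_1\to\infty}\eta_m^*(\cdot;\ell_1,\gamma)$ exists. With $\nu_-^{mm}=1-\sqrt{\frac{\gamma}{\gamma+1}}$, $a=c^2/\ell+s^2$ and $b=s^2/\ell+c^2$, one has $a(\ell)\ell\ne1/\nu_-^{mm}$ for $\ell>1/\nu_-^{mm}$, and $$\eta_{mm}(\lambda(\ell))=\begin{cases}\dfrac{\nu_-^{mm}-b}{a-1/(\ell\cdot\nu_-^{mm})},&\ell>1/\nu_-^{mm},\\[2mm]1,&\ell\le1/\nu_-^{mm}.\end{cases}$$ Moreover $\nu_-(A(\ell,\eta_{mm}(\lambda(\ell))))\ge\nu_-^{mm}$ for all $\ell>1$. (c) (Minimaxity.) $$\sup_{(\ell_i)\in\mathcal L_r}\kappa(\Delta((\ell_i);\eta_{mm}(\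cdot)))=\frac{1+\sqrt{\frac{\gamma}{\gamma+1}}}{1-\sqrt{\frac{\gamma}{\gamma+1}}}.$$
   Context: $\kappa$ denotes condition number; $\nu_-(A)\le\nu_+(A)$ are the eigenvalues of a symmetric $2\times2$ matrix. $\ell_+(\gamma)=1+\sqrt\gamma$, $\lambda_+(\gamma)=(1+\sqrt\gamma)^2$; $\lambda(\ell)=\lambda(\ell;\gamma)=\ell(1+\frac{\gamma}{\ell-1})$ for $\ell>\ell_+(\gamma)$ and $\lambda_+(\gamma)$ for $\ell\le\ell_+(\gamma)$; for $\lambda>\lambda_+(\gamma)$ the inverse is $\ell(\lambda;\gamma)=\frac{\lambda+1-\gamma+\sqrt{(\lambda+1-\gamma)^2-4\lambda}}{2}$. $c=c(\ell;\gamma)=\sqrt{\frac{1-\gamma/(\ell-1)^2}{1+\gamma/(\ell-1)}}$ for $\ell>\ell_+(\gamma)$, $c=0$ for $\ell\le\ell_+(\gamma)$; $s=\sqrt{1-c^2}$. $$A(\ell,\eta)=\begin{bmatrix}\frac{\eta c^2+s^2}{\ell}&\frac{(\eta-1)cs}{\sqrt\ell}\\ \frac{(\eta-1)cs}{\sqrt\ell}&c^2+\eta s^2\end{bmatrix}.$$ A joint nonlinearity $\eta$ assigns to the vector of limiting empirical eigenvalues $(\lambda(\ell_1),\dots,\lambda(\ell_r))$ positive numbers $(\eta_1,\dots,\eta_r)$; a scalar nonlinearity $\eta(\cdot)$ gives $\eta_i=\eta(\lambda(\ell_i))$. $\Delta((\ell_i);\eta)=\bigoplus_{i=1}^rA(\ell_i,\eta_i)\oplus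 I_{p-2r}$ for any $p>2r$ (its condition number does not depend on $p>2r$). $\ell_1^+(\gamma)=1+(\gamma+\sqrt{\gamma^2+8\gamma})/2$. $\eta_1^*(\lambda)=\frac{\ell}{1+\gamma+2\gamma/(\ell-1)}$ with $\ell=\ell(\lambda;\gamma)$ if $\lambda>\lambda_+(\gamma)$ and $\ell(\lambda;\gamma)>\ell_1^+(\gamma)$; $\eta_1^*(\lambda)=1$ otherwise. $\kappa_1^*(\ell;\gamma)=\kappa(A(\ell,\eta_1^*(\lambda(\ell))))$. For $\ell_1>\ell_1^+(\gamma)$ put $\nu_-^{1,*}=\nu_-(A(\ell_1,\eta_1^*(\lambda(\ell_1))))$; then $\eta_m^*(\lambda(\ell);\ell_1,\gamma)=\frac{\nu_-^{1,*}-b}{a-1/(\ell\nu_-^{1,*})}$ if $\ell>1/\nu_-^{1,*}$ and $=1$ if $\ell\le1/\nu_-^{1,*}$, with $a,b$ as in the claim. *)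

theory Defs
  imports "HOL-Library.Extended_Real" "Jordan_Normal_Form.Spectral_Radius"
begin

definition ell_plus :: "real \<Rightarrow> real" where
  "ell_plus \<gamma> = 1 + sqrt \<gamma>"

definition lam_plus :: "real \<Rightarrow> real" where
  "lam_plus \<gamma> = (1 + sqrt \<gamma>)\<^sup>2"

definition lam :: "real \<Rightarrow> real \<Rightarrow> real" where
  "lam \<gamma> l = (if l > ell_plus \<gamma> then l * (1 + \<gamma> / (l - 1)) else lam_plus \<gamma>)"

text \<open>Inverse of \<^term>\<open>lam \<gamma>\<close> on \<open>{ell_plus \<gamma><..}\<close>; only meaningful for arguments
  above \<^term>\<open>lam_plus \<gamma>\<close>.\<close>

definition ell_of :: "real \<Rightarrow> real \<Rightarrow> real" where
  "ell_of \<gamma> x = (x + 1 - \<gamma> + sqrt ((x + 1 - \<gamma>)\<^sup>2 - 4 * x)) / 2"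

definition cosine :: "real \<Rightarrow> real \<Rightarrow> real" where
  "cosine \<gamma> l =
     (if l > ell_plus \<gamma> then sqrt ((1 - \<gamma> / (l - 1)\<^sup>2) / (1 + \<gamma> / (l - 1))) else 0)"

definition sine :: "real \<Rightarrow> real \<Rightarrow> real" where
  "sine \<gamma> l = sqrt (1 - (cosine \<gamma> l)\<^sup>2)"

definition coeff_a :: "real \<Rightarrow> real \<Rightarrow> real" where
  "coeff_a \<gamma> l = (cosine \<gamma> l)\<^sup>2 / l + (sine \<gamma> l)\<^sup>2"

definition coeff_b :: "real \<Rightarrow> real \<Rightarrow> real" where
  "coeff_b \<gamma> l = (sine \<gamma> l)\<^sup>2 / l + (cosine \<gamma> l)\<^sup>2"

definition pivot_block :: "real \<Rightarrow> real \<Rightarrow> real \<Rightarrow> real mat" where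
  "pivot_block \<gamma> l e =
     (let c = cosine \<gamma> l; s = sine \<gamma> l in
      mat_of_rows_list 2
        [[(e * c\<^sup>2 + s\<^sup>2) / l,      (e - 1) * c * s / sqrt l],
         [(e - 1) * c * s / sqrt l, c\<^sup>2 + e * s\<^sup>2]])"

definition nu_minus :: "real mat \<Rightarrow> real" where
  "nu_minus A = Min (spectrum A)"

definition nu_plus :: "real mat \<Rightarrow> real" where
  "nu_plus A = Max (spectrum A)"

text \<open>The condition number of a symmetric positive definite matrix, the only kind of
  matrix to which it is applied below: since
  \<open>det (pivot_block \<gamma> l e) = e / l\<close> and the diagonal entries are positive, the blocks
  are positive definite for \<open>e > 0\<close> and \<open>l > 1\<close>.\<close>

definition cond_number :: "real mat \<Rightarrow> real" where
  "cond_number A = nu_plus A / nu_minus A"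

text \<open>The \<open>p \<times> p\<close> matrix for spikes \<open>ls\<close> and the numbers \<open>es\<close>
  that a nonlinearity assigns to them; \<open>p > 2 * length ls\<close> is intended.\<close>

definition Delta :: "real \<Rightarrow> nat \<Rightarrow> real list \<Rightarrow> real list \<Rightarrow> real mat" where
  "Delta \<gamma> p ls es =
     diag_block_mat (map2 (pivot_block \<gamma>) ls es @ [1\<^sub>m (p - 2 * length ls)])"

definition spike_configs :: "nat \<Rightarrow> real list set" where
  "spike_configs r = {ls. length ls = r \<and> sorted_wrt (>) ls \<and> (\<forall>l\<in>set ls. l > 1)}"

text \<open>A joint nonlinearity sees the spikes only through the vector of their limiting
  eigenvalues; its values are constrained on such vectors only. The scalar
  nonlinearity \<open>h\<close> is the joint nonlinearity \<open>map h\<close>.\<close>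

definition nonlinearities :: "real \<Rightarrow> nat \<Rightarrow> (real list \<Rightarrow> real list) set" where
  "nonlinearities \<gamma> r =
     {\<eta>. \<forall>ls\<in>spike_configs r.
          length (\<eta> (map (lam \<gamma>) ls)) = r \<and> (\<forall>e\<in>set (\<eta> (map (lam \<gamma>) ls)). e > 0)}"

text \<open>Worst-case loss, in the extended reals because it may be infinite.\<close>

definition worst_loss :: "real \<Rightarrow> nat \<Rightarrow> nat \<Rightarrow> (real list \<Rightarrow> real list) \<Rightarrow> ereal" where
  "worst_loss \<gamma> p r \<eta> =
     (SUP ls\<in>spike_configs r. ereal (cond_number (Delta \<gamma> p ls (\<eta> (map (lam \<gamma>) ls)))))"

definition ell1_plus :: "real \<Rightarrow> real" where
  "ell1_plus \<gamma> = 1 + (\<gamma> + sqrt (\<gamma>\<^sup>2 + 8 * \<gamma>)) / 2"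

definition eta1_star :: "real \<Rightarrow> real \<Rightarrow> real" where
  "eta1_star \<gamma> x =
     (if x > lam_plus \<gamma> \<and> ell_of \<gamma> x > ell1_plus \<gamma>
      then ell_of \<gamma> x / (1 + \<gamma> + 2 * \<gamma> / (ell_of \<gamma> x - 1)) else 1)"

definition kappa1_star :: "real \<Rightarrow> real \<Rightarrow> real" where
  "kappa1_star \<gamma> l = cond_number (pivot_block \<gamma> l (eta1_star \<gamma> (lam \<gamma> l)))"

definition kappa1_star_inf :: "real \<Rightarrow> real" where
  "kappa1_star_inf \<gamma> = Lim at_top (kappa1_star \<gamma>)"

text \<open>Intended for \<open>l1 > ell1_plus \<gamma>\<close>.\<close>

definition nu1_star :: "real \<Rightarrow> real \<Rightarrow> real" where
  "nu1_star \<gamma> l1 = nu_minus (pivot_block \<gamma> l1 (eta1_star \<gamma> (lam \<gamma> l1)))"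

text \<open>A function of the empirical eigenvalue \<open>x\<close>: the spike is recovered by
  \<^term>\<open>ell_of \<gamma>\<close> above \<^term>\<open>lam_plus \<gamma>\<close>, and at \<^term>\<open>lam_plus \<gamma>\<close>, where the
  spike is not identifiable, the value is 1. Lemma \<open>etam_star_lam\<close> below gives the
  resulting values in terms of the spike.\<close>

definition etam_star :: "real \<Rightarrow> real \<Rightarrow> real \<Rightarrow> real" where
  "etam_star \<gamma> l1 x =
     (let l = ell_of \<gamma> x; v = nu1_star \<gamma> l1 in
      if x > lam_plus \<gamma> \<and> l > 1 / v
      then (v - coeff_b \<gamma> l) / (coeff_a \<gamma> l - 1 / (l * v)) else 1)"

definition eta_mm :: "real \<Rightarrow> real \<Rightarrow> real" where
  "eta_mm \<gamma> x = Lim at_top (\<lambda>l1. etam_star \<gamma> l1 x)"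

definition nu_mm :: "real \<Rightarrow> real" where
  "nu_mm \<gamma> = 1 - sqrt (\<gamma> / (\<gamma> + 1))"

lemma lam_gt_lam_plus:
  assumes "\<gamma> > 0" "l > ell_plus \<gamma>"
  shows "lam \<gamma> l > lam_plus \<gamma>" and "ell_of \<gamma> (lam \<gamma> l) = l"
proof -
  define g where "g = sqrt \<gamma>"
  define x where "x = l - 1"
  have g: "g > 0" "\<gamma> = g\<^sup>2" and x: "x > g" "l = x + 1"
    using assms by (auto simp: g_def x_def ell_plus_def)
  have x0: "x > 0" using g x by linarith
  have L: "lam \<gamma> l = 1 + g\<^sup>2 + x + g\<^sup>2 / x"
    using assms x0 by (simp add: lam_def x g(2) field_simps)
  have "(x + g\<^sup>2 / x) - 2 * g = (x - g)\<^sup>2 / x"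
    using x0 by (simp add: field_simps power2_eq_square)
  moreover have "(x - g)\<^sup>2 / x > 0" using x x0 by simp
  ultimately have "x + g\<^sup>2 / x > 2 * g" by linarith
  then show "lam \<gamma> l > lam_plus \<gamma>"
    unfolding L by (simp add: lam_plus_def g_def[symmetric] power2_sum)
  have "(lam \<gamma> l + 1 - \<gamma>)\<^sup>2 - 4 * lam \<gamma> l = (x - g\<^sup>2 / x)\<^sup>2"
    unfolding L unfolding g(2) using x0 by (simp add: field_simps power2_eq_square)
  moreover have "x - g\<^sup>2 / x \<ge> 0"
    using x x0 g by (simp add: field_simps power2_eq_square mult_mono)
  ultimately have "sqrt ((lam \<gamma> l + 1 - \<gamma>)\<^sup>2 - 4 * lam \<gamma> l) = x - g\<^sup>2 / x"
    by simp
  then show "ell_of \<gamma> (lam \<gamma> l) = l"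
    unfolding ell_of_def by (simp add: L) (simp add: g(2) x)
qed

lemma pivot_block_carrier: "pivot_block \<gamma> l e \<in> carrier_mat 2 2"
  by (simp add: pivot_block_def mat_of_rows_list_def Let_def numeral_2_eq_2)

lemma det_2x2:
  assumes B: "(B :: real mat) \<in> carrier_mat 2 2"
  shows "det B = B $$ (0,0) * B $$ (1,1) - B $$ (0,1) * B $$ (1,0)"
proof -
  have c: "det (mat_delete B i 0) = mat_delete B i 0 $$ (0,0)" if "i < 2" for i
    using that B by (intro det_single) (auto simp: mat_delete_def)
  show ?thesis
    using laplace_expansion_column[OF B, of 0] B
    by (simp add: numeral_2_eq_2 cofactor_def c[unfolded numeral_2_eq_2])
       (simp add: mat_delete_def)
qed

lemma eigenvalue_2x2_iff:
  assumes A: "(A :: real mat) \<in> carrier_mat 2 2"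
  shows "eigenvalue A k \<longleftrightarrow>
    k\<^sup>2 - (A $$ (0,0) + A $$ (1,1)) * k + (A $$ (0,0) * A $$ (1,1) - A $$ (0,1) * A $$ (1,0)) = 0"
proof -
  have c: "char_matrix A k \<in> carrier_mat 2 2" using A by simp
  show ?thesis
    unfolding eigenvalue_det[OF A] det_2x2[OF c]
    using A by (auto simp: char_matrix_def power2_eq_square algebra_simps)
qed

lemma nu_minus_le:
  assumes A: "(A :: real mat) \<in> carrier_mat 2 2"
    and t: "t\<^sup>2 - (A $$ (0,0) + A $$ (1,1)) * t
      + (A $$ (0,0) * A $$ (1,1) - A $$ (0,1) * A $$ (1,0)) \<le> 0"
  shows "spectrum A \<noteq> {}" and "nu_minus A \<le> t"
proof -
  define T where "T = A $$ (0,0) + A $$ (1,1)"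
  define D where "D = A $$ (0,0) * A $$ (1,1) - A $$ (0,1) * A $$ (1,0)"
  have q: "(t - T / 2)\<^sup>2 \<le> T\<^sup>2 / 4 - D"
    using t unfolding T_def[symmetric] D_def[symmetric]
    by (simp add: power2_eq_square field_simps)
  define d where "d = sqrt (T\<^sup>2 / 4 - D)"
  have "T\<^sup>2 / 4 - D \<ge> 0" using q zero_le_power2[of "t - T / 2"] by linarith
  then have d: "d\<^sup>2 = T\<^sup>2 / 4 - D" by (simp add: d_def)
  have "\<bar>t - T / 2\<bar> \<le> d" unfolding d_def using real_sqrt_le_mono[OF q] by simp
  then have le: "T / 2 - d \<le> t" by linarith
  have "(T / 2 - d)\<^sup>2 - T * (T / 2 - d) + D = d\<^sup>2 - T\<^sup>2 / 4 + D"
    by (simp add: power2_eq_square field_simps)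
  then have "eigenvalue A (T / 2 - d)"
    unfolding eigenvalue_2x2_iff[OF A] T_def[symmetric] D_def[symmetric] using d by simp
  then have mem: "T / 2 - d \<in> spectrum A" by (simp add: spectrum_def)
  then show "spectrum A \<noteq> {}" by blast
  have "nu_minus A \<le> T / 2 - d"
    unfolding nu_minus_def using card_finite_spectrum(1)[OF A] mem by simp
  then show "nu_minus A \<le> t" using le by simp
qed

lemma nu_minus_pos:
  assumes A: "(A :: real mat) \<in> carrier_mat 2 2" and ne: "spectrum A \<noteq> {}"
    and T: "A $$ (0,0) + A $$ (1,1) > 0"
    and D: "A $$ (0,0) * A $$ (1,1) - A $$ (0,1) * A $$ (1,0) > 0"
  shows "nu_minus A > 0"
proof -
  have "nu_minus A \<in> spectrum A"
    unfolding nu_minus_def using card_finite_spectrum(1)[OF A] ne by simp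
  then have "(nu_minus A)\<^sup>2 - (A $$ (0,0) + A $$ (1,1)) * nu_minus A
      + (A $$ (0,0) * A $$ (1,1) - A $$ (0,1) * A $$ (1,0)) = 0"
    using eigenvalue_2x2_iff[OF A] by (simp add: spectrum_def)
  then have "(A $$ (0,0) + A $$ (1,1)) * nu_minus A > 0"
    using D zero_le_power2[of "nu_minus A"] by linarith
  then show ?thesis using T by (simp add: zero_less_mult_iff)
qed

lemma nu1_star_bounds:
  assumes "\<gamma> > 0" "l1 > ell1_plus \<gamma>"
  shows "0 < nu1_star \<gamma> l1" and "nu1_star \<gamma> l1 \<le> 1 / ell_plus \<gamma>"
proof -
  define g where "g = sqrt \<gamma>"
  define x where "x = l1 - 1"
  have g: "g > 0" "\<gamma> = g\<^sup>2" using assms by (auto simp: g_def)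
  define S where "S = sqrt (\<gamma>\<^sup>2 + 8 * \<gamma>)"
  have "S \<ge> sqrt (4 * \<gamma>)"
    unfolding S_def using assms by (intro real_sqrt_le_mono) (auto intro: add_increasing)
  then have "S \<ge> 2 * g" by (simp add: real_sqrt_mult g_def)
  moreover have "x > \<gamma> / 2 + S / 2"
    using assms(2) unfolding x_def ell1_plus_def S_def[symmetric] add_divide_distrib by linarith
  ultimately have xg: "x > g"
    using assms(1) by linarith
  then have x0: "x > 0" using g by linarith
  have l1: "l1 = x + 1" by (simp add: x_def)
  have lp: "l1 > ell_plus \<gamma>" using xg by (simp add: ell_plus_def g_def l1)
  define e where "e = eta1_star \<gamma> (lam \<gamma> l1)"
  have e: "e = (x + 1) * x / ((1 + g\<^sup>2) * x + 2 * g\<^sup>2)"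
    using lam_gt_lam_plus[OF assms(1) lp] assms(2) x0
    by (simp add: e_def eta1_star_def l1 g(2) field_simps)
  define c where "c = cosine \<gamma> l1"
  define s where "s = sine \<gamma> l1"
  have gx: "g\<^sup>2 < x\<^sup>2" using xg g by (simp add: power_strict_mono)
  have den: "x * (x + g\<^sup>2) > 0" "x + g\<^sup>2 > 0" "(1 + g\<^sup>2) * x + 2 * g\<^sup>2 > 0"
    using x0 g by (auto intro!: mult_pos_pos add_pos_pos)
  have "(1 - \<gamma> / (l1 - 1)\<^sup>2) / (1 + \<gamma> / (l1 - 1)) = (x\<^sup>2 - g\<^sup>2) / (x * (x + g\<^sup>2))"
    using x0 den by (simp add: l1 g(2) divide_simps) (simp add: power2_eq_square algebra_simps)
  then have c2: "c\<^sup>2 = (x\<^sup>2 - g\<^sup>2) / (x * (x + g\<^sup>2))"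
    using lp gx den by (simp add: c_def cosine_def)
  have 1: "1 - c\<^sup>2 = g\<^sup>2 * (x + 1) / (x * (x + g\<^sup>2))"
    unfolding c2 using x0 den by (simp add: divide_simps) (simp add: power2_eq_square algebra_simps)
  then have "1 - c\<^sup>2 \<ge> 0" using x0 den g by simp
  then have "s\<^sup>2 = 1 - c\<^sup>2" by (simp add: s_def sine_def c_def)
  then have s2: "s\<^sup>2 = g\<^sup>2 * (x + 1) / (x * (x + g\<^sup>2))" and cs: "c\<^sup>2 + s\<^sup>2 = 1" using 1 by simp_all
  define A where "A = pivot_block \<gamma> l1 e"
  have A: "A \<in> carrier_mat 2 2" unfolding A_def by (rule pivot_block_carrier)
  have ent: "A $$ (0,0) = (e * c\<^sup>2 + s\<^sup>2) / l1" "A $$ (1,1) = c\<^sup>2 + e * s\<^sup>2"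
      "A $$ (0,1) = (e - 1) * c * s / sqrt l1" "A $$ (1,0) = (e - 1) * c * s / sqrt l1"
    by (auto simp: A_def pivot_block_def mat_of_rows_list_def Let_def c_def s_def)
  have "sqrt l1 * sqrt l1 = l1" using x0 by (simp add: l1)
  then have "A $$ (0,1) * A $$ (1,0) = (e - 1)\<^sup>2 * c\<^sup>2 * s\<^sup>2 / l1"
    unfolding ent by (simp add: power2_eq_square mult_ac)
  then have "A $$ (0,0) * A $$ (1,1) - A $$ (0,1) * A $$ (1,0)
      = ((e * c\<^sup>2 + s\<^sup>2) * (c\<^sup>2 + e * s\<^sup>2) - (e - 1)\<^sup>2 * c\<^sup>2 * s\<^sup>2) / l1"
    by (simp only: ent(1,2) diff_divide_distrib) simp
  also have "(e * c\<^sup>2 + s\<^sup>2) * (c\<^sup>2 + e * s\<^sup>2) - (e - 1)\<^sup>2 * c\<^sup>2 * s\<^sup>2 = e * (c\<^sup>2 + s\<^sup>2)\<^sup>2"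
    by (simp add: power2_eq_square algebra_simps)
  also have "e * (c\<^sup>2 + s\<^sup>2)\<^sup>2 / l1 = x / ((1 + g\<^sup>2) * x + 2 * g\<^sup>2)"
    using x0 by (simp add: cs l1 e)
  finally have D: "A $$ (0,0) * A $$ (1,1) - A $$ (0,1) * A $$ (1,0)
      = x / ((1 + g\<^sup>2) * x + 2 * g\<^sup>2)" .
  have "c\<^sup>2 / l1 + s\<^sup>2 = ((1 + g\<^sup>2) * x + 2 * g\<^sup>2) / ((x + 1) * (x + g\<^sup>2))"
    unfolding c2 s2 l1 using x0 den
    by (simp add: divide_simps) (simp add: power2_eq_square algebra_simps)
  then have "e * (c\<^sup>2 / l1 + s\<^sup>2) = x / (x + g\<^sup>2)"
    using x0 den by (simp add: e)
  moreover have "s\<^sup>2 / l1 + c\<^sup>2 = x / (x + g\<^sup>2)"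
    unfolding c2 s2 l1 using x0 den
    by (simp add: divide_simps) (simp add: power2_eq_square algebra_simps)
  moreover have "A $$ (0,0) + A $$ (1,1) = e * (c\<^sup>2 / l1 + s\<^sup>2) + (s\<^sup>2 / l1 + c\<^sup>2)"
    unfolding ent by (simp add: add_divide_distrib algebra_simps)
  ultimately have T: "A $$ (0,0) + A $$ (1,1) = 2 * x / (x + g\<^sup>2)" by simp
  define t where "t = 1 / (1 + g)"
  have g1: "1 + g > 0" using g by simp
  have "t\<^sup>2 - 2 * x / (x + g\<^sup>2) * t + x / ((1 + g\<^sup>2) * x + 2 * g\<^sup>2)
      = - (2 * g ^ 3 * (x - g) * (x + 1)) / ((1 + g)\<^sup>2 * (x + g\<^sup>2) * ((1 + g\<^sup>2) * x + 2 * g\<^sup>2))"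
  proof -
    define P where "P = x + g\<^sup>2"
    define Q where "Q = (1 + g\<^sup>2) * x + 2 * g\<^sup>2"
    have nz: "P \<noteq> 0" "Q \<noteq> 0" "1 + g \<noteq> 0" using den g1 by (auto simp: P_def Q_def)
    have "t\<^sup>2 - 2 * x / P * t + x / Q
        = (P * Q - 2 * x * (1 + g) * Q + x * (1 + g)\<^sup>2 * P) / ((1 + g)\<^sup>2 * P * Q)"
      using nz by (simp add: t_def divide_simps) (simp add: power2_eq_square algebra_simps)
    also have "P * Q - 2 * x * (1 + g) * Q + x * (1 + g)\<^sup>2 * P = - (2 * g ^ 3 * (x - g) * (x + 1))"
      unfolding P_def Q_def by (simp add: power2_eq_square power3_eq_cube algebra_simps)
    finally show ?thesis by (simp add: P_def Q_def)
  qed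
  also have "\<dots> \<le> 0"
    using den g xg x0 by (intro divide_nonpos_nonneg) auto
  finally have pt: "t\<^sup>2 - (A $$ (0,0) + A $$ (1,1)) * t
      + (A $$ (0,0) * A $$ (1,1) - A $$ (0,1) * A $$ (1,0)) \<le> 0"
    unfolding T D .
  have "0 < nu_minus A"
    by (rule nu_minus_pos[OF A nu_minus_le(1)[OF A pt]]; unfold T D) (use x0 den in simp_all)
  then show "0 < nu1_star \<gamma> l1" by (simp add: nu1_star_def A_def e_def)
  show "nu1_star \<gamma> l1 \<le> 1 / ell_plus \<gamma>"
    using nu_minus_le(2)[OF A pt]
    by (simp add: nu1_star_def A_def e_def t_def ell_plus_def g_def)
qed

lemma etam_star_lam:
  assumes "\<gamma> > 0" "l1 > ell1_plus \<gamma>" "l > 1"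
  shows "etam_star \<gamma> l1 (lam \<gamma> l) =
    (if l > 1 / nu1_star \<gamma> l1
     then (nu1_star \<gamma> l1 - coeff_b \<gamma> l) / (coeff_a \<gamma> l - 1 / (l * nu1_star \<gamma> l1)) else 1)"
proof (cases "l > ell_plus \<gamma>")
  case True
  then show ?thesis
    using lam_gt_lam_plus[OF assms(1) True] by (simp add: etam_star_def Let_def)
next
  case False
  have "ell_plus \<gamma> > 0" using assms(1) by (simp add: ell_plus_def add_pos_pos)
  then have "ell_plus \<gamma> \<le> 1 / nu1_star \<gamma> l1"
    using nu1_star_bounds[OF assms(1,2)] by (simp add: field_simps)
  then have "\<not> l > 1 / nu1_star \<gamma> l1" using False by linarith
  moreover have "lam \<gamma> l = lam_plus \<gamma>" using False by (simp add: lam_def)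
  ultimately show ?thesis by (simp add: etam_star_def Let_def)
qed

end

theory Submission
  imports Defs "HOL-Real_Asymp.Real_Asymp"
begin

text \<open>
  The block \<open>A(l, e)\<close> has trace \<open>e a + b\<close> and determinant \<open>e / l\<close>. Its condition number \<open>k\<close>
  therefore satisfies \<open>(1 + k)\<^sup>2 / k = (e a + b)\<^sup>2 l / e \<ge> 4 a b l\<close> by AM-GM, with equality for the
  one-spike optimum \<open>e a = b\<close>. Hence every nonlinearity loses at least
  \<open>\<kappa>\<^sub>1\<^sup>*(l)\<close> on a configuration with top spike \<open>l\<close>, and letting \<open>l\<close> grow gives
  the lower bound. Conversely, the minimax shrinker is the value of \<open>e\<close> for which
  \<open>\<nu> = 1 - w\<close>, \<open>w = sqrt (\<gamma> / (\<gamma> + 1))\<close>, is an eigenvalue; the other eigenvalue is then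
  \<open>e / (l \<nu>)\<close>, which lies in \<open>[1 - w, 1 + w]\<close>, so that all blocks, with the
  identity, have their spectrum in this one interval.
\<close>

section \<open>Spectra of two-by-two and block-diagonal matrices\<close>

lemma spectrum_2x2:
  assumes B: "(B :: real mat) \<in> carrier_mat 2 2"
    and "m + M = B $$ (0,0) + B $$ (1,1)"
    and "m * M = B $$ (0,0) * B $$ (1,1) - B $$ (0,1) * B $$ (1,0)"
  shows "spectrum B = {m, M}"
proof -
  have "eigenvalue B k \<longleftrightarrow> (k - m) * (k - M) = 0" for k
    unfolding eigenvalue_2x2_iff[OF B] assms(2,3)[symmetric]
    by (simp add: power2_eq_square algebra_simps)
  then show ?thesis by (auto simp: spectrum_def)
qed

text \<open>Forming the characteristic matrix respects the block structure, and its determinant is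
  the product of the determinants of the two blocks, which vanishes exactly when a factor
  does.\<close>

lemma eigenvalue_block_diag:
  assumes A: "(A :: real mat) \<in> carrier_mat n n" and B: "B \<in> carrier_mat m m"
  shows "eigenvalue (four_block_mat A (0\<^sub>m n m) (0\<^sub>m m n) B) k
    \<longleftrightarrow> eigenvalue A k \<or> eigenvalue B k"
proof -
  have C: "four_block_mat A (0\<^sub>m n m) (0\<^sub>m m n) B \<in> carrier_mat (n + m) (n + m)"
    using A B by simp
  have "char_matrix (four_block_mat A (0\<^sub>m n m) (0\<^sub>m m n) B) k
      = four_block_mat (char_matrix A k) (0\<^sub>m n m) (0\<^sub>m m n) (char_matrix B k)"
    using A B by (intro eq_matI) (auto simp: char_matrix_def)
  then show ?thesis
    using det_four_block_mat_lower_left_zero[of "char_matrix A k" n "0\<^sub>m n m" m "0\<^sub>m m n" "char_matrix B k"]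
      A B by (simp add: eigenvalue_det[OF C] eigenvalue_det[OF A] eigenvalue_det[OF B])
qed

lemma spectrum_diag_block_mat:
  assumes "\<forall>A\<in>set As. square_mat (A :: real mat)"
  shows "spectrum (diag_block_mat As) = (\<Union>A\<in>set As. spectrum A)"
  using assms
proof (induction As)
  case Nil
  \<comment> \<open>In dimension 0 the only vector is zero, which is no eigenvector; so the spectrum
    is the empty union.\<close>
  have "\<not> eigenvalue (0\<^sub>m 0 0 :: real mat) k" for k
    by (auto simp: eigenvalue_def eigenvector_def)
  then show ?case by (auto simp: spectrum_def)
next
  case (Cons A As)
  then have "A \<in> carrier_mat (dim_row A) (dim_row A)"
    and "diag_block_mat As \<in> carrier_mat (dim_row (diag_block_mat As)) (dim_row (diag_block_mat As))"
    using diag_block_mat_square[of As] by auto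
  from eigenvalue_block_diag[OF this] show ?case
    using Cons diag_block_mat_square[of As] by (auto simp: spectrum_def Let_def)
qed

lemma spectrum_one_mat:
  assumes "n > 0"
  shows "spectrum (1\<^sub>m n :: real mat) = {1}"
proof -
  have "eigenvalue (1\<^sub>m n :: real mat) k \<longleftrightarrow> k = 1" for k
  proof -
    have "char_matrix (1\<^sub>m n :: real mat) k = (1 - k) \<cdot>\<^sub>m 1\<^sub>m n"
      by (intro eq_matI) (auto simp: char_matrix_def)
    then show ?thesis
      using assms by (simp add: eigenvalue_det[of _ n])
  qed
  then show ?thesis by (auto simp: spectrum_def)
qed

text \<open>The identity block has positive size because \<open>p > 2 * length ls\<close>, so it
  contributes exactly the eigenvalue 1. This is where the independence of \<open>p\<close> comes
  from.\<close>

lemma spectrum_Delta: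
  assumes "length es = length ls" "p > 2 * length ls"
  shows "spectrum (Delta \<gamma> p ls es)
    = insert 1 (\<Union>(l, e)\<in>set (zip ls es). spectrum (pivot_block \<gamma> l e))"
proof -
  have sq: "square_mat (pivot_block \<gamma> l e)" for l e
    using pivot_block_carrier[of \<gamma> l e] by simp
  have "spectrum (Delta \<gamma> p ls es)
      = (\<Union>A\<in>set (map2 (pivot_block \<gamma>) ls es @ [1\<^sub>m (p - 2 * length ls)]). spectrum A)"
    unfolding Delta_def by (rule spectrum_diag_block_mat) (use sq in auto)
  then show ?thesis
    using assms(2) by (auto simp: spectrum_one_mat)
qed

section \<open>Coefficients, trace, determinant and eigenvalues of one block\<close>

lemma ell_plus_gt_1:
  assumes "\<gamma> > 0"
  shows "ell_plus \<gamma> > 1"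
  using assms by (simp add: ell_plus_def)

context
  fixes \<gamma> l :: real
  assumes \<gamma>: "\<gamma> > 0"
begin

text \<open>Above \<open>ell_plus \<gamma>\<close> one has l - 1 > sqrt \<gamma>, so the radicand in
  \<open>cosine\<close> is nonnegative and squaring removes the root.\<close>

lemma cosine_sq:
  assumes "l > ell_plus \<gamma>"
  shows "(cosine \<gamma> l)\<^sup>2 = ((l - 1)\<^sup>2 - \<gamma>) / ((l - 1) * (l - 1 + \<gamma>))"
proof -
  define x where "x = l - 1"
  have x: "x > sqrt \<gamma>" "x > 0"
    using assms ell_plus_gt_1[OF \<gamma>] unfolding x_def ell_plus_def by linarith+
  then have "(sqrt \<gamma>)\<^sup>2 < x\<^sup>2" using \<gamma> by (intro power_strict_mono) auto
  then have gx: "\<gamma> < x\<^sup>2" using \<gamma> by simp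
  have "(1 - \<gamma> / x\<^sup>2) / (1 + \<gamma> / x) = (x\<^sup>2 - \<gamma>) / (x * (x + \<gamma>))"
    using x \<gamma> by (simp add: divide_simps) (simp add: power2_eq_square algebra_simps)
  moreover have "(1 - \<gamma> / x\<^sup>2) / (1 + \<gamma> / x) \<ge> 0"
    using x \<gamma> gx by (intro divide_nonneg_nonneg) auto
  ultimately show ?thesis
    using assms by (simp add: cosine_def x_def[symmetric])
qed

text \<open>Since \<open>sine\<close> is a root of 1 - c^2, the identity rests on c^2 \<le> 1, which
  above \<open>ell_plus \<gamma>\<close> is read off from \<open>cosine_sq\<close>.\<close>

lemma sine_cosine_sq: "(cosine \<gamma> l)\<^sup>2 + (sine \<gamma> l)\<^sup>2 = 1"
proof -
  have "(cosine \<gamma> l)\<^sup>2 \<le> 1"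
  proof (cases "l > ell_plus \<gamma>")
    case True
    then have "l - 1 > 0" using ell_plus_gt_1[OF \<gamma>] by simp
    moreover have "(l - 1)\<^sup>2 - \<gamma> \<le> (l - 1) * (l - 1 + \<gamma>)"
      using \<gamma> \<open>l - 1 > 0\<close> mult_pos_pos[OF \<open>l - 1 > 0\<close> \<gamma>]
      by (simp only: power2_eq_square distrib_left)
    ultimately show ?thesis
      unfolding cosine_sq[OF True] using \<gamma> by (intro divide_le_eq_1_pos[THEN iffD2]) auto
  qed (simp add: cosine_def)
  then show ?thesis by (simp add: sine_def)
qed

text \<open>The numerator of a is l - 1 times the denominator 1 + \<gamma> + 2 \<gamma> / (l - 1) of
  \<open>eta1_star\<close>; this is why the one-spike optimum satisfies e a = b.\<close>

lemma coeff_explicit: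
  assumes "l > ell_plus \<gamma>"
  shows "coeff_a \<gamma> l = ((1 + \<gamma>) * (l - 1) + 2 * \<gamma>) / (l * (l - 1 + \<gamma>))"
    and "coeff_b \<gamma> l = (l - 1) / (l - 1 + \<gamma>)"
proof -
  define x where "x = l - 1"
  have x: "x > 0" "l = x + 1" using assms ell_plus_gt_1[OF \<gamma>] by (auto simp: x_def)
  have c: "(cosine \<gamma> l)\<^sup>2 = (x\<^sup>2 - \<gamma>) / (x * (x + \<gamma>))"
    using cosine_sq[OF assms] by (simp add: x_def)
  have "(sine \<gamma> l)\<^sup>2 = 1 - (cosine \<gamma> l)\<^sup>2" using sine_cosine_sq by simp
  also have "\<dots> = \<gamma> * (x + 1) / (x * (x + \<gamma>))"
    unfolding c using x \<gamma> by (simp add: divide_simps) (simp add: power2_eq_square algebra_simps)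
  finally have s: "(sine \<gamma> l)\<^sup>2 = \<gamma> * (x + 1) / (x * (x + \<gamma>))" .
  have nz: "x \<noteq> 0" "x + 1 \<noteq> 0" "x + \<gamma> \<noteq> 0" using x \<gamma> by auto
  have "coeff_a \<gamma> l = ((1 + \<gamma>) * x + 2 * \<gamma>) / ((x + 1) * (x + \<gamma>))"
    unfolding coeff_a_def c s unfolding x(2)
    using nz by (simp add: divide_simps) (simp add: power2_eq_square algebra_simps)
  then show "coeff_a \<gamma> l = ((1 + \<gamma>) * (l - 1) + 2 * \<gamma>) / (l * (l - 1 + \<gamma>))"
    by (simp add: x_def)
  have "coeff_b \<gamma> l = x / (x + \<gamma>)"
    unfolding coeff_b_def c s unfolding x(2)
    using nz by (simp add: divide_simps) (simp add: power2_eq_square algebra_simps)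
  then show "coeff_b \<gamma> l = (l - 1) / (l - 1 + \<gamma>)" by (simp add: x_def)
qed

lemma coeff_pos:
  assumes "l > 1"
  shows "coeff_a \<gamma> l > 0" "coeff_b \<gamma> l > 0"
proof -
  have "(cosine \<gamma> l)\<^sup>2 > 0 \<or> (sine \<gamma> l)\<^sup>2 > 0"
    using sine_cosine_sq zero_le_power2[of "cosine \<gamma> l"] zero_le_power2[of "sine \<gamma> l"] by linarith
  then show "coeff_a \<gamma> l > 0" "coeff_b \<gamma> l > 0"
    unfolding coeff_a_def coeff_b_def using assms
    by (auto intro: add_pos_nonneg add_nonneg_pos)
qed

text \<open>Because c^2 + s^2 = 1, the difference a b - 1/l equals c^2 s^2 (1 - 1/l)^2. The bound
  keeps the discriminant of the block nonnegative for every e > 0.\<close>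

lemma coeff_prod_ge:
  assumes "l > 1"
  shows "coeff_a \<gamma> l * coeff_b \<gamma> l \<ge> 1 / l"
proof -
  define C where "C = (cosine \<gamma> l)\<^sup>2"
  define S where "S = (sine \<gamma> l)\<^sup>2"
  have CS: "C \<ge> 0" "S \<ge> 0" "C + S = 1" using sine_cosine_sq by (auto simp: C_def S_def)
  have "coeff_a \<gamma> l * coeff_b \<gamma> l - (C + S)\<^sup>2 / l = C * S * (l - 1)\<^sup>2 / l\<^sup>2"
    unfolding coeff_a_def coeff_b_def C_def[symmetric] S_def[symmetric] using assms
    by (simp add: divide_simps) (simp add: power2_eq_square algebra_simps)
  moreover have "C * S * (l - 1)\<^sup>2 / l\<^sup>2 \<ge> 0" using CS by simp
  ultimately show ?thesis unfolding CS(3) power_one by linarith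
qed

text \<open>With R the rotation with cosine c and sine s, the block is D R diag(e, 1) R^T D for D =
  diag(1/sqrt l, 1). Hence the determinant is e / l, whatever the angle.\<close>

lemma pivot_block_trace_det:
  assumes "l > 1"
  shows "pivot_block \<gamma> l e $$ (0,0) + pivot_block \<gamma> l e $$ (1,1) = e * coeff_a \<gamma> l + coeff_b \<gamma> l"
    and "pivot_block \<gamma> l e $$ (0,0) * pivot_block \<gamma> l e $$ (1,1)
      - pivot_block \<gamma> l e $$ (0,1) * pivot_block \<gamma> l e $$ (1,0) = e / l"
proof -
  define c where "c = cosine \<gamma> l"
  define s where "s = sine \<gamma> l"
  have ent: "pivot_block \<gamma> l e $$ (0,0) = (e * c\<^sup>2 + s\<^sup>2) / l"
      "pivot_block \<gamma> l e $$ (1,1) = c\<^sup>2 + e * s\<^sup>2"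
      "pivot_block \<gamma> l e $$ (0,1) = (e - 1) * c * s / sqrt l"
      "pivot_block \<gamma> l e $$ (1,0) = (e - 1) * c * s / sqrt l"
    by (auto simp: pivot_block_def mat_of_rows_list_def Let_def c_def s_def)
  show "pivot_block \<gamma> l e $$ (0,0) + pivot_block \<gamma> l e $$ (1,1) = e * coeff_a \<gamma> l + coeff_b \<gamma> l"
    unfolding ent coeff_a_def coeff_b_def c_def[symmetric] s_def[symmetric]
    by (simp add: add_divide_distrib algebra_simps)
  have "sqrt l * sqrt l = l" using assms by simp
  then have "pivot_block \<gamma> l e $$ (0,1) * pivot_block \<gamma> l e $$ (1,0) = (e - 1)\<^sup>2 * c\<^sup>2 * s\<^sup>2 / l"
    unfolding ent by (simp add: power2_eq_square mult_ac)
  then have "pivot_block \<gamma> l e $$ (0,0) * pivot_block \<gamma> l e $$ (1,1)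
      - pivot_block \<gamma> l e $$ (0,1) * pivot_block \<gamma> l e $$ (1,0)
      = ((e * c\<^sup>2 + s\<^sup>2) * (c\<^sup>2 + e * s\<^sup>2) - (e - 1)\<^sup>2 * c\<^sup>2 * s\<^sup>2) / l"
    by (simp only: ent(1,2) diff_divide_distrib) simp
  also have "(e * c\<^sup>2 + s\<^sup>2) * (c\<^sup>2 + e * s\<^sup>2) - (e - 1)\<^sup>2 * c\<^sup>2 * s\<^sup>2 = e * (c\<^sup>2 + s\<^sup>2)\<^sup>2"
    by (simp add: power2_eq_square algebra_simps)
  finally show "pivot_block \<gamma> l e $$ (0,0) * pivot_block \<gamma> l e $$ (1,1)
      - pivot_block \<gamma> l e $$ (0,1) * pivot_block \<gamma> l e $$ (1,0) = e / l"
    using sine_cosine_sq by (simp add: c_def s_def)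
qed

lemma spectrum_pivot_block:
  assumes "l > 1" "m + M = e * coeff_a \<gamma> l + coeff_b \<gamma> l" "m * M = e / l"
  shows "spectrum (pivot_block \<gamma> l e) = {m, M}"
  by (rule spectrum_2x2[OF pivot_block_carrier]) (simp_all only: pivot_block_trace_det[OF assms(1)] assms(2,3))

text \<open>The eigenvalues are T/2 - d and T/2 + d with trace T. AM-GM gives T^2 \<ge> 4 e a b, and
  a b \<ge> 1/l turns this into a nonnegative discriminant. The last inequality is the same AM-GM
  bound with e = l m M.\<close>

lemma pivot_block_eigenvalues:
  assumes "l > 1" "e > 0"
  obtains m M where "0 < m" "m \<le> M" "spectrum (pivot_block \<gamma> l e) = {m, M}"
    "m + M = e * coeff_a \<gamma> l + coeff_b \<gamma> l" "m * M = e / l"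
    "(m + M)\<^sup>2 \<ge> 4 * coeff_a \<gamma> l * coeff_b \<gamma> l * l * (m * M)"
proof -
  define T where "T = e * coeff_a \<gamma> l + coeff_b \<gamma> l"
  define D where "D = e / l"
  have pos: "T > 0" "D > 0" using coeff_pos assms by (auto simp: T_def D_def intro: add_pos_pos)
  have "T\<^sup>2 - 4 * (e * coeff_a \<gamma> l * coeff_b \<gamma> l) = (e * coeff_a \<gamma> l - coeff_b \<gamma> l)\<^sup>2"
    by (simp add: T_def power2_eq_square algebra_simps)
  then have amgm: "T\<^sup>2 \<ge> 4 * (e * coeff_a \<gamma> l * coeff_b \<gamma> l)"
    by (metis diff_ge_0_iff_ge zero_le_power2)
  have "D \<le> e * (coeff_a \<gamma> l * coeff_b \<gamma> l)"
    using mult_left_mono[OF coeff_prod_ge[OF assms(1)], of e] assms(2) by (simp add: D_def)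
  then have disc: "T\<^sup>2 / 4 - D \<ge> 0" using amgm unfolding mult.assoc by linarith
  define d where "d = sqrt (T\<^sup>2 / 4 - D)"
  have d: "d \<ge> 0" "d\<^sup>2 = T\<^sup>2 / 4 - D" using disc by (auto simp: d_def)
  \<comment> \<open>A positive determinant keeps d strictly below T/2, so the smaller root is
    positive.\<close>
  have "d\<^sup>2 < (T / 2)\<^sup>2" using d(2) pos by (simp add: power2_eq_square)
  then have "d < T / 2" by (rule power2_less_imp_less) (use pos in simp)
  moreover have prod: "(T / 2 - d) * (T / 2 + d) = D"
    using d(2) by (simp add: power2_eq_square algebra_simps)
  moreover have "spectrum (pivot_block \<gamma> l e) = {T / 2 - d, T / 2 + d}"
    using prod by (intro spectrum_pivot_block assms) (auto simp: T_def D_def)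
  moreover have "T\<^sup>2 \<ge> 4 * coeff_a \<gamma> l * coeff_b \<gamma> l * l * D"
    using amgm assms by (simp add: D_def mult_ac)
  ultimately show ?thesis
    using d(1) by (intro that[of "T / 2 - d" "T / 2 + d"]) (simp_all add: T_def D_def)
qed

end

section \<open>Condition numbers read off from spectra\<close>

lemma cond_number_2:
  assumes "spectrum A = {m, M}" "m \<le> M"
  shows "nu_minus A = m" "nu_plus A = M" "cond_number A = M / m"
  using assms by (auto simp: nu_minus_def nu_plus_def cond_number_def)

text \<open>A larger spectrum has a smaller minimum and a larger maximum. Applied to a single block
  inside \<open>Delta\<close>, this reduces the lower bound to one spike.\<close>

lemma cond_number_mono:
  assumes "finite (spectrum B)" "\<forall>t\<in>spectrum B. t > 0" "spectrum A \<subseteq> spectrum B" "spectrum A \<noteq> {}"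
  shows "cond_number A \<le> cond_number B"
proof -
  have "nu_minus B \<le> nu_minus A" "nu_plus A \<le> nu_plus B"
    unfolding nu_minus_def nu_plus_def using assms by (auto intro: Min_antimono Max_mono)
  moreover have "nu_minus B \<in> spectrum B" "nu_plus A \<in> spectrum A"
    unfolding nu_minus_def nu_plus_def using assms finite_subset[OF assms(3,1)]
    by (auto intro!: Min_in Max_in)
  then have "nu_minus B > 0" "nu_plus A > 0" using assms by auto
  ultimately show ?thesis
    unfolding cond_number_def by (intro frac_le) auto
qed

lemma cond_number_le:
  assumes "finite (spectrum A)" "spectrum A \<noteq> {}" "spectrum A \<subseteq> {u..U}" "u > 0"
  shows "cond_number A \<le> U / u"
proof -
  have "nu_minus A \<in> spectrum A" "nu_plus A \<in> spectrum A"
    unfolding nu_minus_def nu_plus_def using assms by auto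
  then show ?thesis
    unfolding cond_number_def using assms by (intro frac_le) (auto simp: subset_iff intro: order_trans)
qed

text \<open>The function (1 + k)^2 / k = k + 2 + 1/k is strictly increasing for k \<ge> 1. For k =
  M/m it equals (m + M)^2 / (m M), so condition numbers can be compared through trace and
  determinant.\<close>

lemma le_of_plus_inverse_le:
  fixes q k :: real
  assumes "1 \<le> q" "1 \<le> k" "(1 + k)\<^sup>2 / k \<le> (1 + q)\<^sup>2 / q"
  shows "k \<le> q"
proof (rule ccontr)
  assume "\<not> k \<le> q"
  then have "k > q" by simp
  then have "k * q > 1 * 1"
    using assms by (intro mult_less_le_imp_less) auto
  then have "(k - q) * (k * q - 1) > 0" using \<open>k > q\<close> by simp
  moreover have "(1 + k)\<^sup>2 * q - (1 + q)\<^sup>2 * k = (k - q) * (k * q - 1)"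
    by (simp add: power2_eq_square algebra_simps)
  ultimately show False using assms by (simp add: field_simps)
qed

text \<open>This is the candidate for the limit, as a function of the spike instead of the empirical
  eigenvalue. The first branch solves the characteristic equation of the block at
  \<open>nu_mm \<gamma>\<close>, which is linear in e.\<close>

definition spike_shrinker :: "real \<Rightarrow> real \<Rightarrow> real" where
  "spike_shrinker \<gamma> l =
     (if l > 1 / nu_mm \<gamma> then (nu_mm \<gamma> - coeff_b \<gamma> l) / (coeff_a \<gamma> l - 1 / (l * nu_mm \<gamma>)) else 1)"

section \<open>One-spike optimum and its limit for large spikes\<close>

context
  fixes \<gamma> :: real
  assumes \<gamma>: "\<gamma> > 0"
begin

text \<open>The balance e a = b is the equality case of AM-GM for the trace e a + b; the quotient by
  l is the determinant of the block.\<close>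

lemma eta1_star_lam:
  assumes "l > ell_plus \<gamma>" "l > ell1_plus \<gamma>"
  shows "eta1_star \<gamma> (lam \<gamma> l) > 0"
    and "eta1_star \<gamma> (lam \<gamma> l) * coeff_a \<gamma> l = coeff_b \<gamma> l"
    and "eta1_star \<gamma> (lam \<gamma> l) / l = (l - 1) / ((1 + \<gamma>) * (l - 1) + 2 * \<gamma>)"
proof -
  define x where "x = l - 1"
  have x: "x > 0" "l = x + 1" using assms ell_plus_gt_1[OF \<gamma>] by (auto simp: x_def)
  define q where "q = (1 + \<gamma>) * x + 2 * \<gamma>"
  have q: "q > 0" using x \<gamma> by (auto simp: q_def intro: add_pos_pos)
  have "eta1_star \<gamma> (lam \<gamma> l) = l / (1 + \<gamma> + 2 * \<gamma> / x)"
    using lam_gt_lam_plus[OF \<gamma> assms(1)] assms(2) by (simp add: eta1_star_def x_def)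
  also have "1 + \<gamma> + 2 * \<gamma> / x = q / x" using x by (simp add: q_def field_simps)
  finally have e: "eta1_star \<gamma> (lam \<gamma> l) = l * x / q" by simp
  show "eta1_star \<gamma> (lam \<gamma> l) > 0" unfolding e using x q by simp
  have a: "coeff_a \<gamma> l = q / (l * (x + \<gamma>))" and b: "coeff_b \<gamma> l = x / (x + \<gamma>)"
    using coeff_explicit[OF \<gamma> assms(1)] by (auto simp: x_def q_def)
  show "eta1_star \<gamma> (lam \<gamma> l) * coeff_a \<gamma> l = coeff_b \<gamma> l"
    unfolding e a b using x q \<gamma> by simp
  show "eta1_star \<gamma> (lam \<gamma> l) / l = (l - 1) / ((1 + \<gamma>) * (l - 1) + 2 * \<gamma>)"
    unfolding e using x by (simp add: q_def)
qed

text \<open>At e a = b the trace is 2 b, so the eigenvalues are b - d and b + d, and trace^2 / det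
  attains its AM-GM lower bound 4 a b l.\<close>

lemma one_spike_optimum:
  assumes "l > ell_plus \<gamma>" "l > ell1_plus \<gamma>"
  defines "b \<equiv> (l - 1) / (l - 1 + \<gamma>)"
  defines "d \<equiv> sqrt (b\<^sup>2 - (l - 1) / ((1 + \<gamma>) * (l - 1) + 2 * \<gamma>))"
  shows "nu1_star \<gamma> l = b - d" "kappa1_star \<gamma> l = (b + d) / (b - d)"
    and "1 \<le> kappa1_star \<gamma> l"
    and "(1 + kappa1_star \<gamma> l)\<^sup>2 / kappa1_star \<gamma> l = 4 * coeff_a \<gamma> l * coeff_b \<gamma> l * l"
proof -
  have l: "l > 1" using assms ell_plus_gt_1[OF \<gamma>] by simp
  define e where "e = eta1_star \<gamma> (lam \<gamma> l)"
  have b: "b = coeff_b \<gamma> l" using coeff_explicit[OF \<gamma> assms(1)] by (simp add: b_def)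
  have e: "e > 0" "e * coeff_a \<gamma> l = b" "e / l = (l - 1) / ((1 + \<gamma>) * (l - 1) + 2 * \<gamma>)"
    using eta1_star_lam[OF assms(1,2)] by (auto simp: e_def b)
  obtain m M where mM: "0 < m" "m \<le> M" "spectrum (pivot_block \<gamma> l e) = {m, M}"
    "m + M = e * coeff_a \<gamma> l + coeff_b \<gamma> l" "m * M = e / l"
    using pivot_block_eigenvalues[OF \<gamma> l e(1)] by metis
  have S: "m + M = 2 * b" using mM(4) e(2) b by simp
  \<comment> \<open>As b is the mean of the eigenvalues, the radicand of d is the square of half
    their gap.\<close>
  have "b\<^sup>2 - m * M = ((M - m) / 2)\<^sup>2"
  proof -
    have "b = (m + M) / 2" using S by simp
    then show ?thesis by (simp only:) (simp add: power2_eq_square field_simps)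
  qed
  then have "d = (M - m) / 2"
    unfolding d_def using mM(2,5) e(3) by simp
  then have bd: "b - d = m" "b + d = M" using S by auto
  have N: "nu_minus (pivot_block \<gamma> l e) = m" "kappa1_star \<gamma> l = M / m"
    using cond_number_2[OF mM(3,2)] by (auto simp: kappa1_star_def e_def)
  show "nu1_star \<gamma> l = b - d" "kappa1_star \<gamma> l = (b + d) / (b - d)"
    using N by (auto simp: bd nu1_star_def e_def)
  show "1 \<le> kappa1_star \<gamma> l" using N mM by simp
  have "(1 + M / m)\<^sup>2 / (M / m) = (m + M)\<^sup>2 / (m * M)"
    using mM(1,2) by (simp add: field_simps power2_eq_square)
  also have "\<dots> = 4 * b * (e * coeff_a \<gamma> l) / (e / l)"
    unfolding S mM(5) e(2) by (simp add: power2_eq_square)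
  also have "\<dots> = 4 * coeff_a \<gamma> l * b * l" using e(1) l by simp
  finally show "(1 + kappa1_star \<gamma> l)\<^sup>2 / kappa1_star \<gamma> l = 4 * coeff_a \<gamma> l * coeff_b \<gamma> l * l"
    using N b by simp
qed

text \<open>The quotient trace^2 / det is at least 4 a b l for every e > 0 and equals it at the
  one-spike optimum; monotonicity of (1 + k)^2 / k transfers this to condition numbers.\<close>

lemma cond_pivot_block_ge:
  assumes "l > ell_plus \<gamma>" "l > ell1_plus \<gamma>" "e > 0"
  shows "cond_number (pivot_block \<gamma> l e) \<ge> kappa1_star \<gamma> l"
proof -
  have l: "l > 1" using assms ell_plus_gt_1[OF \<gamma>] by simp
  obtain m M where mM: "0 < m" "m \<le> M" "spectrum (pivot_block \<gamma> l e) = {m, M}"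
    "(m + M)\<^sup>2 \<ge> 4 * coeff_a \<gamma> l * coeff_b \<gamma> l * l * (m * M)"
    using pivot_block_eigenvalues[OF \<gamma> l assms(3)] by metis
  have "(1 + M / m)\<^sup>2 / (M / m) = (m + M)\<^sup>2 / (m * M)"
    using mM(1,2) by (simp add: field_simps power2_eq_square)
  moreover have "\<dots> \<ge> 4 * coeff_a \<gamma> l * coeff_b \<gamma> l * l"
    using mM by (simp add: pos_le_divide_eq)
  ultimately have "(1 + kappa1_star \<gamma> l)\<^sup>2 / kappa1_star \<gamma> l \<le> (1 + M / m)\<^sup>2 / (M / m)"
    using one_spike_optimum(4)[OF assms(1,2)] by simp
  then show ?thesis
    unfolding cond_number_2(3)[OF mM(3,2)]
    using le_of_plus_inverse_le[of "M / m" "kappa1_star \<gamma> l"] one_spike_optimum(3)[OF assms(1,2)] mM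
    by simp
qed

lemma eventually_large: "eventually (\<lambda>l. l > ell_plus \<gamma> \<and> l > ell1_plus \<gamma>) at_top"
  by (intro eventually_conj eventually_gt_at_top)

lemma nu_mm_bounds: "0 < nu_mm \<gamma>" "nu_mm \<gamma> < 1"
  using \<gamma> by (auto simp: nu_mm_def)

text \<open>As l grows, b tends to 1 and the determinant to 1 / (1 + \<gamma>), so d tends to sqrt
  (\<gamma> / (\<gamma> + 1)).\<close>

lemma one_spike_limits:
  "((\<lambda>l. nu1_star \<gamma> l) \<longlongrightarrow> nu_mm \<gamma>) at_top"
  "(kappa1_star \<gamma> \<longlongrightarrow> (1 + sqrt (\<gamma> / (\<gamma> + 1))) / (1 - sqrt (\<gamma> / (\<gamma> + 1)))) at_top"
proof -
  define b where "b = (\<lambda>l. (l - 1) / (l - 1 + \<gamma>))"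
  define d where "d = (\<lambda>l. sqrt ((b l)\<^sup>2 - (l - 1) / ((1 + \<gamma>) * (l - 1) + 2 * \<gamma>)))"
  have b: "(b \<longlongrightarrow> 1) at_top" unfolding b_def by real_asymp
  have L: "((\<lambda>l. (l - 1) / ((1 + \<gamma>) * (l - 1) + 2 * \<gamma>)) \<longlongrightarrow> 1 / (1 + \<gamma>)) at_top"
    using \<gamma> by (real_asymp simp: field_simps)
  have "(d \<longlongrightarrow> sqrt (1\<^sup>2 - 1 / (1 + \<gamma>))) at_top"
    unfolding d_def by (intro tendsto_real_sqrt tendsto_diff tendsto_power b L)
  also have "1\<^sup>2 - 1 / (1 + \<gamma>) = \<gamma> / (\<gamma> + 1)" using \<gamma> by (simp add: field_simps)
  finally have d: "(d \<longlongrightarrow> sqrt (\<gamma> / (\<gamma> + 1))) at_top" .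
  have "((\<lambda>l. b l - d l) \<longlongrightarrow> nu_mm \<gamma>) at_top"
    unfolding nu_mm_def by (intro tendsto_intros b d)
  then show "((\<lambda>l. nu1_star \<gamma> l) \<longlongrightarrow> nu_mm \<gamma>) at_top"
    by (rule Lim_transform_eventually)
      (use eventually_large in eventually_elim, simp add: one_spike_optimum b_def d_def)
  have "((\<lambda>l. (b l + d l) / (b l - d l)) \<longlongrightarrow>
      (1 + sqrt (\<gamma> / (\<gamma> + 1))) / (1 - sqrt (\<gamma> / (\<gamma> + 1)))) at_top"
    using nu_mm_bounds by (intro tendsto_intros b d) (simp add: nu_mm_def)
  then show "(kappa1_star \<gamma> \<longlongrightarrow> (1 + sqrt (\<gamma> / (\<gamma> + 1))) / (1 - sqrt (\<gamma> / (\<gamma> + 1)))) at_top"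
    by (rule Lim_transform_eventually)
      (use eventually_large in eventually_elim, simp add: one_spike_optimum b_def d_def)
qed

section \<open>The shrinker and its block in closed form\<close>

text \<open>The claim amounts to \<gamma> (1 - w)^2 < w^2, which follows from (1 - w)^2 < 1 - w^2 =
  1 / (\<gamma> + 1). It makes the closed forms of a and b available from the threshold on.\<close>

lemma ell_plus_less_threshold: "ell_plus \<gamma> < 1 / nu_mm \<gamma>"
proof -
  define w where "w = sqrt (\<gamma> / (\<gamma> + 1))"
  have w: "0 < w" "w < 1" "w\<^sup>2 = \<gamma> / (\<gamma> + 1)" using \<gamma> by (auto simp: w_def)
  have "\<gamma> * (1 - w)\<^sup>2 < w\<^sup>2"
  proof -
    have "(1 - w)\<^sup>2 < 1 - w\<^sup>2" using w(1,2) mult_strict_left_mono[of w 1 w]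
      by (simp add: power2_eq_square algebra_simps)
    also have "1 - w\<^sup>2 = 1 / (\<gamma> + 1)" using \<gamma> by (simp add: w(3) field_simps)
    finally have "\<gamma> * (1 - w)\<^sup>2 < \<gamma> * (1 / (\<gamma> + 1))" using \<gamma> by (intro mult_strict_left_mono)
    then show ?thesis by (simp add: w(3))
  qed
  then have "(sqrt \<gamma> * (1 - w))\<^sup>2 < w\<^sup>2" using \<gamma> by (simp add: power_mult_distrib)
  then have "sqrt \<gamma> * (1 - w) < w" by (rule power2_less_imp_less) (use w in simp)
  then show ?thesis
    using w(1,2) unfolding ell_plus_def nu_mm_def w_def[symmetric] by (simp add: field_simps)
qed

lemma shrinker_numerator_denominator:
  assumes "l \<ge> 1 / nu_mm \<gamma>"
  defines "w \<equiv> sqrt (\<gamma> / (\<gamma> + 1))"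
  shows "nu_mm \<gamma> - coeff_b \<gamma> l = - (w * ((1 + w) * (l - 1) - w)) / ((1 + w) * (l - 1 + \<gamma>))"
    and "coeff_a \<gamma> l - 1 / (l * nu_mm \<gamma>)
      = - (w * ((1 - w) * (l - 1) - w + 2 * w\<^sup>2)) / ((1 - w\<^sup>2) * (l * nu_mm \<gamma> * (l - 1 + \<gamma>)))"
    and "0 < w" "w < 1" "(1 - w) * (l - 1) \<ge> w"
proof -
  define x where "x = l - 1"
  define v where "v = 1 - w"
  show w: "0 < w" "w < 1" using \<gamma> by (auto simp: w_def)
  have "w\<^sup>2 = \<gamma> / (\<gamma> + 1)" using \<gamma> by (simp add: w_def)
  \<comment> \<open>This relation trades \<gamma> for w: the expressions below are multiplied by 1 +
    w or 1 - w^2 until \<gamma> enters only through it.\<close>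
  then have gw: "\<gamma> * (1 - w\<^sup>2) = w\<^sup>2" using \<gamma> by (simp add: field_simps)
  have v: "nu_mm \<gamma> = v" by (simp add: nu_mm_def w_def v_def)
  show "(1 - w) * (l - 1) \<ge> w"
    using assms(1) w unfolding v v_def by (simp add: field_simps)
  have L: "l > ell_plus \<gamma>" using assms ell_plus_less_threshold by simp
  have x: "x > 0" "l = x + 1" using L ell_plus_gt_1[OF \<gamma>] by (auto simp: x_def)
  have nz: "x + \<gamma> \<noteq> 0" "1 + w \<noteq> 0" "l \<noteq> 0" "v \<noteq> 0" "1 - w\<^sup>2 \<noteq> 0"
    using x \<gamma> w power_strict_mono[of w 1 2] by (auto simp: v_def)
  have b: "coeff_b \<gamma> l = x / (x + \<gamma>)" and a: "coeff_a \<gamma> l = ((1 + \<gamma>) * x + 2 * \<gamma>) / (l * (x + \<gamma>))"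
    using coeff_explicit[OF \<gamma> L] by (auto simp: x_def)
  have "(1 + w) * (v * (x + \<gamma>) - x) = \<gamma> * (1 - w\<^sup>2) - w * (1 + w) * x"
    by (simp add: v_def power2_eq_square algebra_simps)
  also have "\<dots> = - (w * ((1 + w) * x - w))" unfolding gw by (simp add: power2_eq_square algebra_simps)
  finally have n: "v * (x + \<gamma>) - x = - (w * ((1 + w) * x - w)) / (1 + w)"
    using nz by (simp add: field_simps)
  have "v - coeff_b \<gamma> l = (v * (x + \<gamma>) - x) / (x + \<gamma>)"
    unfolding b using nz by (simp add: field_simps)
  then show "nu_mm \<gamma> - coeff_b \<gamma> l = - (w * ((1 + w) * (l - 1) - w)) / ((1 + w) * (l - 1 + \<gamma>))"
    unfolding n unfolding v x_def by simp
  have "(1 - w\<^sup>2) * (((1 + \<gamma>) * x + 2 * \<gamma>) * v - (x + \<gamma>))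
      = (1 - w\<^sup>2) * x * (v - 1) + \<gamma> * (1 - w\<^sup>2) * (x * v + 2 * v - 1)"
    by (simp add: algebra_simps)
  also have "\<dots> = - (w * ((1 - w) * x - w + 2 * w\<^sup>2))"
    unfolding gw v_def by (simp add: power2_eq_square algebra_simps)
  finally have N: "((1 + \<gamma>) * x + 2 * \<gamma>) * v - (x + \<gamma>) = - (w * ((1 - w) * x - w + 2 * w\<^sup>2)) / (1 - w\<^sup>2)"
    using nz by (simp add: field_simps)
  have "coeff_a \<gamma> l - 1 / (l * v) = (((1 + \<gamma>) * x + 2 * \<gamma>) * v - (x + \<gamma>)) / (l * v * (x + \<gamma>))"
    unfolding a using nz by (simp add: divide_simps)
  then show "coeff_a \<gamma> l - 1 / (l * nu_mm \<gamma>)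
      = - (w * ((1 - w) * (l - 1) - w + 2 * w\<^sup>2)) / ((1 - w\<^sup>2) * (l * nu_mm \<gamma> * (l - 1 + \<gamma>)))"
    unfolding N unfolding v x_def by simp
qed

text \<open>By (1 - w) (l - 1) \<ge> w the decisive factor is at least 2 w^2. The threshold itself
  is included, as the limit there needs it.\<close>

lemma shrinker_denominator_neg:
  assumes "l \<ge> 1 / nu_mm \<gamma>"
  shows "coeff_a \<gamma> l - 1 / (l * nu_mm \<gamma>) < 0"
proof -
  note * = shrinker_numerator_denominator[OF assms]
  define w where "w = sqrt (\<gamma> / (\<gamma> + 1))"
  note * = *[folded w_def]
  have "l > 1" using assms ell_plus_less_threshold ell_plus_gt_1[OF \<gamma>] by simp
  moreover have "1 - w\<^sup>2 > 0" using *(3,4) power_strict_mono[of w 1 2] by simp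
  moreover have "(1 - w) * (l - 1) - w + 2 * w\<^sup>2 > 0"
    using *(3,5) by (intro add_nonneg_pos) auto
  ultimately show ?thesis
    unfolding *(2) using *(3) \<gamma> nu_mm_bounds by (intro divide_neg_pos) auto
qed

lemma shrinker_explicit:
  assumes "l \<ge> 1 / nu_mm \<gamma>"
  defines "w \<equiv> sqrt (\<gamma> / (\<gamma> + 1))"
  shows "(nu_mm \<gamma> - coeff_b \<gamma> l) / (coeff_a \<gamma> l - 1 / (l * nu_mm \<gamma>))
    = l * (1 - w)\<^sup>2 * ((1 + w) * (l - 1) - w) / ((1 - w) * (l - 1) - w + 2 * w\<^sup>2)"
proof -
  note * = shrinker_numerator_denominator[OF assms(1), folded w_def]
  have v: "nu_mm \<gamma> = 1 - w" by (simp add: nu_mm_def w_def)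
  have l: "l > 1" using assms ell_plus_less_threshold ell_plus_gt_1[OF \<gamma>] by simp
  define n where "n = (1 + w) * (l - 1) - w"
  define q where "q = (1 - w) * (l - 1) - w + 2 * w\<^sup>2"
  define y where "y = l - 1 + \<gamma>"
  have pos: "q > 0" "y > 0" "1 + w > 0" "1 - w > 0"
    using *(3-5) l \<gamma> unfolding q_def by (auto simp: y_def intro: add_nonneg_pos)
  have s: "1 - w\<^sup>2 = (1 + w) * (1 - w)" by (simp add: power2_eq_square algebra_simps)
  have "(- (w * n) / ((1 + w) * y)) / (- (w * q) / ((1 + w) * (1 - w) * (l * (1 - w) * y)))
      = l * (1 - w)\<^sup>2 * n / q"
    using pos l *(3) by (simp add: power2_eq_square)
  then show ?thesis
    unfolding *(1,2) unfolding s v n_def q_def y_def .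
qed

text \<open>At l - 1 = w / (1 - w) the closed form is 1, so the two branches of
  \<open>spike_shrinker\<close> join continuously.\<close>

lemma spike_shrinker_at_threshold:
  "(nu_mm \<gamma> - coeff_b \<gamma> (1 / nu_mm \<gamma>)) / (coeff_a \<gamma> (1 / nu_mm \<gamma>) - 1 / (1 / nu_mm \<gamma> * nu_mm \<gamma>)) = 1"
proof -
  define w where "w = sqrt (\<gamma> / (\<gamma> + 1))"
  have v: "nu_mm \<gamma> = 1 - w" by (simp add: nu_mm_def w_def)
  have w: "0 < w" "1 - w > 0"
    using shrinker_numerator_denominator(3,4)[of "1 / nu_mm \<gamma>"] by (auto simp: w_def)
  have x: "1 / (1 - w) - 1 = w / (1 - w)" using w by (simp add: field_simps)
  have "(1 + w) * (w / (1 - w)) - w = 2 * w\<^sup>2 / (1 - w)"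
    using w by (simp add: field_simps power2_eq_square)
  moreover have "(1 - w) * (w / (1 - w)) - w + 2 * w\<^sup>2 = 2 * w\<^sup>2" using w by simp
  ultimately show ?thesis
    unfolding shrinker_explicit[OF order.refl, folded w_def] unfolding v x
    using w by (simp add: power2_eq_square)
qed

text \<open>Up to the threshold e = 1 and the eigenvalues are 1/l and 1. Beyond it one eigenvalue is
  \<open>nu_mm \<gamma>\<close> by the choice of e, and the determinant e / l fixes the other,
  M.\<close>

lemma spectrum_spike_shrinker:
  assumes "l > 1"
  shows "spike_shrinker \<gamma> l > 0"
    and "\<exists>m M. spectrum (pivot_block \<gamma> l (spike_shrinker \<gamma> l)) = {m, M}
      \<and> nu_mm \<gamma> \<le> m \<and> m \<le> M \<and> M \<le> 1 + sqrt (\<gamma> / (\<gamma> + 1))"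
proof -
  define w where "w = sqrt (\<gamma> / (\<gamma> + 1))"
  have v: "nu_mm \<gamma> = 1 - w" by (simp add: nu_mm_def w_def)
  have w: "0 < w" "w < 1" using \<gamma> by (auto simp: w_def)
  have "spike_shrinker \<gamma> l > 0 \<and> (\<exists>m M. spectrum (pivot_block \<gamma> l (spike_shrinker \<gamma> l)) = {m, M}
      \<and> nu_mm \<gamma> \<le> m \<and> m \<le> M \<and> M \<le> 1 + w)"
  proof (cases "l > 1 / nu_mm \<gamma>")
    case False
    have "coeff_a \<gamma> l + coeff_b \<gamma> l
        = ((cosine \<gamma> l)\<^sup>2 + (sine \<gamma> l)\<^sup>2) / l + ((cosine \<gamma> l)\<^sup>2 + (sine \<gamma> l)\<^sup>2)"
      unfolding coeff_a_def coeff_b_def by (simp add: add_divide_distrib)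
    then have "coeff_a \<gamma> l + coeff_b \<gamma> l = 1 / l + 1"
      by (simp add: sine_cosine_sq[OF \<gamma>])
    then have "spectrum (pivot_block \<gamma> l 1) = {1 / l, 1}"
      using assms by (intro spectrum_pivot_block \<gamma>) auto
    moreover have "nu_mm \<gamma> \<le> 1 / l"
      using False assms nu_mm_bounds by (simp add: field_simps)
    moreover have "1 / l \<le> 1" "(1::real) \<le> 1 + w" using assms w by auto
    moreover have "spike_shrinker \<gamma> l = 1" using False by (simp add: spike_shrinker_def)
    ultimately show ?thesis
      by (intro conjI exI[of _ "1 / l"] exI[of _ 1]) simp_all
  next
    case True
    then have ge: "l \<ge> 1 / nu_mm \<gamma>" by simp
    define e where "e = spike_shrinker \<gamma> l"
    have e: "e = (nu_mm \<gamma> - coeff_b \<gamma> l) / (coeff_a \<gamma> l - 1 / (l * nu_mm \<gamma>))"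
      using True by (simp add: e_def spike_shrinker_def)
    define n where "n = (1 + w) * (l - 1) - w"
    define q where "q = (1 - w) * (l - 1) - w + 2 * w\<^sup>2"
    have e': "e = l * (1 - w)\<^sup>2 * n / q"
      unfolding e shrinker_explicit[OF ge] by (simp add: n_def q_def w_def)
    have x: "(1 - w) * (l - 1) \<ge> w"
      using shrinker_numerator_denominator(5)[OF ge] by (simp add: w_def)
    then have q: "q > 0" using w unfolding q_def by (intro add_nonneg_pos) auto
    have "(1 - w) * (l - 1) \<le> 1 * (l - 1)"
      using w assms by (intro mult_right_mono) auto
    then have "w \<le> l - 1" using x by simp
    then have "2 * w * (l - 1 - w) \<ge> 0" using w by simp
    \<comment> \<open>For M = (1 - w) n / q the bound M \<ge> 1 - w means n \<ge> q; it uses l - 1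
      \<ge> w.\<close>
    moreover have "n - q = 2 * w * (l - 1 - w)"
      by (simp add: n_def q_def power2_eq_square algebra_simps)
    ultimately have nq: "n \<ge> q" by linarith
    \<comment> \<open>This gives M \<le> 1 + w. The terms in l cancel, so the slack is the same for
      all spikes.\<close>
    have "(1 + w) * q - (1 - w) * n = 2 * w ^ 3"
      by (simp add: n_def q_def power2_eq_square power3_eq_cube algebra_simps)
    moreover have "2 * w ^ 3 > 0" using w by simp
    ultimately have le: "(1 - w) * n \<le> (1 + w) * q" by linarith
    define M where "M = e / (l * nu_mm \<gamma>)"
    have M: "M = (1 - w) * n / q"
      using assms w by (simp add: M_def e' v power2_eq_square)
    have "1 - w \<le> M" "M \<le> 1 + w"
      unfolding M using q nq le w by (simp_all add: pos_le_divide_eq pos_divide_le_eq)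
    moreover have "spectrum (pivot_block \<gamma> l e) = {nu_mm \<gamma>, M}"
    proof (rule spectrum_pivot_block[OF \<gamma> assms])
      have "e * (coeff_a \<gamma> l - 1 / (l * nu_mm \<gamma>)) = nu_mm \<gamma> - coeff_b \<gamma> l"
        unfolding e using shrinker_denominator_neg[OF ge] by simp
      then show "nu_mm \<gamma> + M = e * coeff_a \<gamma> l + coeff_b \<gamma> l"
        by (simp add: M_def algebra_simps)
      show "nu_mm \<gamma> * M = e / l" using nu_mm_bounds by (simp add: M_def)
    qed
    moreover have "e > 0" unfolding e' using q nq w assms by simp
    ultimately show ?thesis
      unfolding e_def[symmetric] v by (intro conjI exI[of _ "1 - w"] exI[of _ M]) simp_all
  qed
  then show "spike_shrinker \<gamma> l > 0" and "\<exists>m M. spectrum (pivot_block \<gamma> l (spike_shrinker \<gamma> l)) = {m, M}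
      \<and> nu_mm \<gamma> \<le> m \<and> m \<le> M \<and> M \<le> 1 + sqrt (\<gamma> / (\<gamma> + 1))"
    by (auto simp: w_def)
qed

section \<open>The pointwise limit of the shrinkers\<close>

text \<open>Strictly on either side of the threshold the branch is eventually constant in l1, and
  continuity in \<open>nu1_star\<close> does the rest.\<close>

lemma etam_star_tendsto:
  assumes "l > 1"
  shows "((\<lambda>l1. etam_star \<gamma> l1 (lam \<gamma> l)) \<longlongrightarrow> spike_shrinker \<gamma> l) at_top"
proof -
  define F where "F = (\<lambda>v. (v - coeff_b \<gamma> l) / (coeff_a \<gamma> l - 1 / (l * v)))"
  have formula: "eventually (\<lambda>l1. (if l > 1 / nu1_star \<gamma> l1 then F (nu1_star \<gamma> l1) else 1)
      = etam_star \<gamma> l1 (lam \<gamma> l)) at_top"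
    using eventually_large
    by eventually_elim (simp add: etam_star_lam[OF \<gamma> _ assms] F_def)
  have inv: "((\<lambda>l1. 1 / nu1_star \<gamma> l1) \<longlongrightarrow> 1 / nu_mm \<gamma>) at_top"
    using nu_mm_bounds by (intro tendsto_intros one_spike_limits) auto
  have Flim: "((\<lambda>l1. F (nu1_star \<gamma> l1)) \<longlongrightarrow> F (nu_mm \<gamma>)) at_top" if "l \<ge> 1 / nu_mm \<gamma>"
    unfolding F_def using shrinker_denominator_neg[OF that] nu_mm_bounds assms
    by (intro tendsto_intros one_spike_limits) auto
  have "((\<lambda>l1. if l > 1 / nu1_star \<gamma> l1 then F (nu1_star \<gamma> l1) else 1) \<longlongrightarrow> spike_shrinker \<gamma> l) at_top"
  proof (cases l "1 / nu_mm \<gamma>" rule: linorder_cases)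
    case less
    have "eventually (\<lambda>l1. 1 / nu1_star \<gamma> l1 > l) at_top"
      using order_tendstoD(1)[OF inv less] .
    then have "eventually (\<lambda>l1. 1 = (if l > 1 / nu1_star \<gamma> l1 then F (nu1_star \<gamma> l1) else 1)) at_top"
      by eventually_elim auto
    then show ?thesis
      using less by (intro Lim_transform_eventually[OF tendsto_const]) (simp add: spike_shrinker_def)
  next
    case equal
    have "F (nu_mm \<gamma>) = 1" unfolding F_def equal by (rule spike_shrinker_at_threshold)
    then have "((\<lambda>l1. F (nu1_star \<gamma> l1)) \<longlongrightarrow> 1) at_top" using Flim equal by simp
    \<comment> \<open>At the threshold the branch taken may vary with l1, but both branches tend to
      1.\<close>
    then have "((\<lambda>l1. if l > 1 / nu1_star \<gamma> l1 then F (nu1_star \<gamma> l1) else 1) \<longlongrightarrow> 1) at_top"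
      by (intro filterlim_If tendsto_const) (auto intro: tendsto_mono[OF inf_le1])
    then show ?thesis using equal by (simp add: spike_shrinker_def)
  next
    case greater
    have "eventually (\<lambda>l1. 1 / nu1_star \<gamma> l1 < l) at_top"
      using order_tendstoD(2)[OF inv greater] .
    then have "eventually (\<lambda>l1. F (nu1_star \<gamma> l1) = (if l > 1 / nu1_star \<gamma> l1 then F (nu1_star \<gamma> l1) else 1)) at_top"
      by eventually_elim auto
    moreover have "spike_shrinker \<gamma> l = F (nu_mm \<gamma>)" using greater by (simp add: spike_shrinker_def F_def)
    ultimately show ?thesis using Flim greater by (auto intro: Lim_transform_eventually)
  qed
  then show ?thesis using formula by (rule Lim_transform_eventually)
qed

lemma eta_mm_lam:
  assumes "l > 1"
  shows "eta_mm \<gamma> (lam \<gamma> l) = spike_shrinker \<gamma> l"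
  unfolding eta_mm_def by (rule tendsto_Lim[OF trivial_limit_at_top_linorder etam_star_tendsto[OF assms]])

section \<open>Lower and upper bounds for the worst-case loss\<close>

lemma worst_loss_ge:
  assumes "\<eta> \<in> nonlinearities \<gamma> r" "r \<ge> 1" "p > 2 * r"
  shows "worst_loss \<gamma> p r \<eta> \<ge> ereal ((1 + sqrt (\<gamma> / (\<gamma> + 1))) / (1 - sqrt (\<gamma> / (\<gamma> + 1))))"
proof (rule tendsto_upperbound)
  show "((\<lambda>l. ereal (kappa1_star \<gamma> l)) \<longlongrightarrow>
      ereal ((1 + sqrt (\<gamma> / (\<gamma> + 1))) / (1 - sqrt (\<gamma> / (\<gamma> + 1))))) at_top"
    by (intro tendsto_intros one_spike_limits)
  show "eventually (\<lambda>l. ereal (kappa1_star \<gamma> l) \<le> worst_loss \<gamma> p r \<eta>) at_top"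
    using eventually_large eventually_gt_at_top[of "real r + 1"]
  proof eventually_elim
    case (elim l)
    \<comment> \<open>Spikes at unit distance below l; l > r + 1 keeps them all above 1, and l
      itself sits at index 0.\<close>
    define ls where "ls = map (\<lambda>i. l - real i) [0..<r]"
    have ls: "ls \<in> spike_configs r"
      using elim by (auto simp: spike_configs_def ls_def sorted_wrt_iff_nth_less)
    define es where "es = \<eta> (map (lam \<gamma>) ls)"
    have es: "length es = r" "\<forall>e\<in>set es. e > 0"
      using assms(1) ls by (auto simp: nonlinearities_def es_def)
    have lls: "length ls = r" by (simp add: ls_def)
    have sp: "spectrum (Delta \<gamma> p ls es)
        = insert 1 (\<Union>(l, e)\<in>set (zip ls es). spectrum (pivot_block \<gamma> l e))"
      using assms(3) lls es by (intro spectrum_Delta) auto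
    \<comment> \<open>Positivity of the assigned values suffices: it makes every block positive
      definite, as comparing condition numbers requires.\<close>
    have blocks: "finite (spectrum (pivot_block \<gamma> l' e)) \<and> (\<forall>t\<in>spectrum (pivot_block \<gamma> l' e). t > 0)"
      if "(l', e) \<in> set (zip ls es)" for l' e
    proof -
      have "l' > 1" "e > 0"
        using that ls es by (auto dest: set_zip_leftD set_zip_rightD simp: spike_configs_def)
      from pivot_block_eigenvalues[OF \<gamma> this] show ?thesis by (metis insertE empty_iff finite.simps less_le_trans)
    qed
    have "(ls ! 0, es ! 0) \<in> set (zip ls es)"
      using assms(2) lls es(1) by (auto simp: set_zip)
    then have mem: "(l, es ! 0) \<in> set (zip ls es)"
      using assms(2) by (simp add: ls_def)
    then have e0: "es ! 0 > 0" using es by (auto dest: set_zip_rightD)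
    have "l > 1" using elim by simp
    have "spectrum (pivot_block \<gamma> l (es ! 0)) \<noteq> {}"
      using pivot_block_eigenvalues[OF \<gamma> \<open>l > 1\<close> e0] by (metis insert_not_empty)
    then have "cond_number (pivot_block \<gamma> l (es ! 0)) \<le> cond_number (Delta \<gamma> p ls es)"
      using blocks mem unfolding sp by (intro cond_number_mono) (auto simp: sp)
    moreover have "kappa1_star \<gamma> l \<le> cond_number (pivot_block \<gamma> l (es ! 0))"
      using elim e0 by (intro cond_pivot_block_ge) auto
    ultimately show ?case
      unfolding worst_loss_def by (intro SUP_upper2[OF ls]) (simp add: es_def)
  qed
qed simp

lemma eta_mm_nonlinearity: "map (eta_mm \<gamma>) \<in> nonlinearities \<gamma> r"
  using spectrum_spike_shrinker(1) eta_mm_lam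
  by (auto simp: nonlinearities_def spike_configs_def)

text \<open>All blocks and the identity have their spectrum in [1 - w, 1 + w], so the number of
  spikes and their positions do not affect the bound.\<close>

lemma worst_loss_eta_mm_le:
  assumes "p > 2 * r"
  shows "worst_loss \<gamma> p r (map (eta_mm \<gamma>))
    \<le> ereal ((1 + sqrt (\<gamma> / (\<gamma> + 1))) / (1 - sqrt (\<gamma> / (\<gamma> + 1))))"
  unfolding worst_loss_def
proof (intro SUP_least, simp only: ereal_less_eq)
  fix ls assume ls: "ls \<in> spike_configs r"
  define w where "w = sqrt (\<gamma> / (\<gamma> + 1))"
  define es where "es = map (eta_mm \<gamma>) (map (lam \<gamma>) ls)"
  have sp: "spectrum (Delta \<gamma> p ls es)
      = insert 1 (\<Union>(l, e)\<in>set (zip ls es). spectrum (pivot_block \<gamma> l e))"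
    using assms ls by (intro spectrum_Delta) (auto simp: es_def spike_configs_def)
  have blocks: "finite (spectrum (pivot_block \<gamma> l e)) \<and> spectrum (pivot_block \<gamma> l e) \<subseteq> {1 - w..1 + w}"
    if "(l, e) \<in> set (zip ls es)" for l e
  proof -
    have l: "l > 1" using that ls by (auto dest: set_zip_leftD simp: spike_configs_def)
    have "e = eta_mm \<gamma> (lam \<gamma> l)" using that by (auto simp: es_def set_zip)
    then have "e = spike_shrinker \<gamma> l" using eta_mm_lam[OF l] by simp
    then show ?thesis
      using spectrum_spike_shrinker(2)[OF l] by (auto simp: nu_mm_def w_def)
  qed
  have w: "0 < w" "w < 1" using \<gamma> by (auto simp: w_def)
  have "cond_number (Delta \<gamma> p ls es) \<le> (1 + w) / (1 - w)"
  proof (rule cond_number_le)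
    show "finite (spectrum (Delta \<gamma> p ls es))" "spectrum (Delta \<gamma> p ls es) \<noteq> {}"
      using blocks unfolding sp by auto
    show "spectrum (Delta \<gamma> p ls es) \<subseteq> {1 - w..1 + w}"
      using blocks w unfolding sp by fastforce
  qed (use w in simp)
  then show "cond_number (Delta \<gamma> p ls (map (eta_mm \<gamma>) (map (lam \<gamma>) ls)))
      \<le> (1 + sqrt (\<gamma> / (\<gamma> + 1))) / (1 - sqrt (\<gamma> / (\<gamma> + 1)))"
    by (simp add: es_def w_def)
qed

end

theorem theorem5p1p1:
  fixes \<gamma> :: real and r p :: nat
  assumes "\<gamma> > 0" and "r \<ge> 1" and "p > 2 * r"
  shows
    "((kappa1_star \<gamma> \<longlongrightarrow> kappa1_star_inf \<gamma>) at_top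
      \<and> (INF \<eta>\<in>nonlinearities \<gamma> r. worst_loss \<gamma> p r \<eta>) = ereal (kappa1_star_inf \<gamma>)
      \<and> kappa1_star_inf \<gamma> = (1 + sqrt (\<gamma> / (\<gamma> + 1))) / (1 - sqrt (\<gamma> / (\<gamma> + 1))))
     \<and>
     ((\<forall>l>1. ((\<lambda>l1. etam_star \<gamma> l1 (lam \<gamma> l)) \<longlongrightarrow> eta_mm \<gamma> (lam \<gamma> l)) at_top)
      \<and> (\<forall>l>1 / nu_mm \<gamma>. coeff_a \<gamma> l * l \<noteq> 1 / nu_mm \<gamma>)
      \<and> (\<forall>l>1. eta_mm \<gamma> (lam \<gamma> l) =
           (if l > 1 / nu_mm \<gamma>
            then (nu_mm \<gamma> - coeff_b \<gamma> l) / (coeff_a \<gamma> l - 1 / (l * nu_mm \<gamma>))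
            else 1))
      \<and> (\<forall>l>1. nu_minus (pivot_block \<gamma> l (eta_mm \<gamma> (lam \<gamma> l))) \<ge> nu_mm \<gamma>))
     \<and>
     (map (eta_mm \<gamma>) \<in> nonlinearities \<gamma> r
      \<and> worst_loss \<gamma> p r (map (eta_mm \<gamma>))
          = ereal ((1 + sqrt (\<gamma> / (\<gamma> + 1))) / (1 - sqrt (\<gamma> / (\<gamma> + 1)))))"
proof -
  define K where "K = (1 + sqrt (\<gamma> / (\<gamma> + 1))) / (1 - sqrt (\<gamma> / (\<gamma> + 1)))"
  have lim: "(kappa1_star \<gamma> \<longlongrightarrow> K) at_top"
    unfolding K_def by (rule one_spike_limits(2)[OF assms(1)])
  then have inf: "kappa1_star_inf \<gamma> = K"
    unfolding kappa1_star_inf_def by (rule tendsto_Lim[OF trivial_limit_at_top_linorder])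
  have ge: "worst_loss \<gamma> p r \<eta> \<ge> ereal K" if "\<eta> \<in> nonlinearities \<gamma> r" for \<eta>
    unfolding K_def by (rule worst_loss_ge[OF assms(1) that assms(2,3)])
  note mem = eta_mm_nonlinearity[OF assms(1), of r]
  have mm: "worst_loss \<gamma> p r (map (eta_mm \<gamma>)) = ereal K"
    using ge[OF mem] worst_loss_eta_mm_le[OF assms(1,3)] by (intro antisym) (auto simp: K_def)
  have "(INF \<eta>\<in>nonlinearities \<gamma> r. worst_loss \<gamma> p r \<eta>) = ereal K"
    using mem mm ge by (intro antisym INF_greatest) (auto intro: INF_lower2)
  moreover have "((\<lambda>l1. etam_star \<gamma> l1 (lam \<gamma> l)) \<longlongrightarrow> eta_mm \<gamma> (lam \<gamma> l)) at_top" if "l > 1" for l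
    using etam_star_tendsto[OF assms(1) that] eta_mm_lam[OF assms(1) that] by simp
  moreover have "coeff_a \<gamma> l * l \<noteq> 1 / nu_mm \<gamma>" if "l > 1 / nu_mm \<gamma>" for l
  proof
    \<comment> \<open>Equality would make the denominator of the shrinker vanish, but it is
      negative.\<close>
    assume eq: "coeff_a \<gamma> l * l = 1 / nu_mm \<gamma>"
    have "l \<noteq> 0" using that nu_mm_bounds(1)[OF assms(1)] by (auto simp: zero_less_divide_iff not_less)
    then have "coeff_a \<gamma> l = 1 / (l * nu_mm \<gamma>)" using eq by (metis divide_divide_eq_left' nonzero_mult_div_cancel_right)
    then show False using shrinker_denominator_neg[OF assms(1), of l] that by simp
  qed
  moreover have "eta_mm \<gamma> (lam \<gamma> l) = (if l > 1 / nu_mm \<gamma>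
      then (nu_mm \<gamma> - coeff_b \<gamma> l) / (coeff_a \<gamma> l - 1 / (l * nu_mm \<gamma>)) else 1)" if "l > 1" for l
    unfolding eta_mm_lam[OF assms(1) that] spike_shrinker_def ..
  moreover have "nu_minus (pivot_block \<gamma> l (eta_mm \<gamma> (lam \<gamma> l))) \<ge> nu_mm \<gamma>" if "l > 1" for l
    using spectrum_spike_shrinker(2)[OF assms(1) that] cond_number_2(1)
    unfolding eta_mm_lam[OF assms(1) that] by metis
  ultimately show ?thesis
    using lim mem mm unfolding inf K_def by (intro conjI allI impI refl)
qed

end
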